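(* Let $P\subset\mathbb{R}^2$ be a convex polygon with $m\ge 3$ vertices containing the origin in its interior. Let $v_1,\dots,v_m$ be the consecutive vertices of $P$ (indices mod $m$), and $e_1,\dots,e_m$ the consecutive vertices of $P^\circ$ (indices mod $m$), so that $\langle e_i,v_i\rangle=\langle e_i,v_{i-1}\rangle=1$ for all $i$. For $\lambda\in(0,1)$ put $G_{i,j}:=1-\lambda\langle e_i,v_j\rangle$. Let $V_P(\lambda):=\omega_2\operatorname{Vol}_P(B_P(R))$ with $R=-\log(1-\lambda)$. Then $$\frac{dV_P(\lambda)}{d\lambda}=\sum_{i,j=1}^m\lambda\cdot\left|\log\frac{G_{i,j}G_{i+1,j+1}}{G_{i,j+1}G_{i+1,j}}\right|\cdot\frac{\big|\langle e_i,v_j\rangle\langle e_{i+1},v_{j+1}\rangle-\langle e_i,v_{j+1}\rangle\langle e_{i+1},v_j\rangle\big|}{\big|G_{i,j}G_{i+1,j+1}-G_{i,j+1}G_{i+1,j}\big|}$$ $$=\sum_{i,j=1}^m\left|\log\frac{G_{i,j}G_{i+1,j+1}}{G_{i,j+1}G_{i+1,j}}\right|\cdot\left|\lambda-\frac{\langle e_i,v_j\rangle+\langle e_{i+1},v_{j+1}\rangle-\langle e_i,v_{j+1}\rangle-\langle e_{i+1},v_j\rangle}{\langle e_i,v_j\rangle\langle e_{i+1},v_{j+1}\rangle-\langle e_i,v_{j+1}\rangle\langle e_{i+1},v_j\rangle}\right|^{-1}.$$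
   Context: For a convex body $K\subset\mathbb{R}^n$ (convex, bounded, nonempty interior) and $x\in\operatorname{int}K$, let $K^x:=(K-x)^\circ=\{\xi:\langle\xi,y-x\rangle\le 1\ \text{for all } y\in K\}$ be the polar body of $K$ with respect to $x$, and $K^\circ:=K^0$ the polar with respect to the origin. The forward Funk metric ball of radius $R>0$ centered at the origin (assumed interior to $K$) is $B_K(R):=(1-e^{-R})K$. The Holmes--Thompson volume of the Funk geometry on $K$ is $\operatorname{Vol}_K(U):=\frac{1}{\omega_n}\int_U|K^x|\,dx$ for Borel $U\subset\operatorname{int}K$, where $|\cdot|$ is Lebesgue measure and $\omega_n$ is the volume of the Euclidean unit ball in $\mathbb{R}^n$ (so $\omega_2=\pi$).
   Formalization: Both displayed sums need a factor 1/2 to equal dV_P/dλ: for P=[-1,1]^2, V_P=8 artanh(λ)^2 but the sums give 32 artanh(λ)/(1-λ^2), twice the derivative. Where a denominator vanishes (a summand is 0/0), summands are read as limits in λ. *)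

theory Defs
  imports "HOL-Analysis.Analysis"
begin

definition polar_at :: "'a::euclidean_space set \<Rightarrow> 'a \<Rightarrow> 'a set" where
  "polar_at K x = {\<xi>. \<forall>y\<in>K. \<xi> \<bullet> (y - x) \<le> 1}"

abbreviation polar :: "'a::euclidean_space set \<Rightarrow> 'a set" where
  "polar K \<equiv> polar_at K 0"

definition funk_ball :: "'a::euclidean_space set \<Rightarrow> real \<Rightarrow> 'a set" where
  "funk_ball K R = (\<lambda>x. (1 - exp (- R)) *\<^sub>R x) ` K"

definition unit_ball_measure :: "'a::euclidean_space itself \<Rightarrow> real" where
  "unit_ball_measure _ = measure lborel (ball (0::'a) 1)"

text \<open>The integral is the real-valued Bochner integral, so the definition is meant for Borel sets
  \<open>U \<subseteq> interior K\<close> of finite volume. This covers closed balls \<open>(1 - exp (- R)) K\<close>, which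
  are compact subsets of \<open>interior K\<close> when \<open>K\<close> is compact and \<open>0 \<in> interior K\<close>.\<close>
definition funk_volume :: "'a::euclidean_space set \<Rightarrow> 'a set \<Rightarrow> real" where
  "funk_volume K U =
     (1 / unit_ball_measure TYPE('a)) * (LINT x:U|lborel. measure lborel (polar_at K x))"

definition ball_volume_fun :: "'a::euclidean_space set \<Rightarrow> real \<Rightarrow> real" where
  "ball_volume_fun K lam =
     unit_ball_measure TYPE('a) * funk_volume K (funk_ball K (- ln (1 - lam)))"

text \<open>Indices modulo \<open>m\<close> are rendered by \<open>m\<close>-periodic families over the integers. The edge condition
  expresses that the enumeration follows the boundary (in either orientation).\<close>
definition consecutive_vertices :: "(real^2) set \<Rightarrow> nat \<Rightarrow> (int \<Rightarrow> real^2) \<Rightarrow> bool" where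
  "consecutive_vertices P m v \<longleftrightarrow>
     (\<forall>i. v (i + int m) = v i) \<and>
     inj_on v {1..int m} \<and>
     v ` {1..int m} = {x. x extreme_point_of P} \<and>
     (\<forall>i. closed_segment (v i) (v (i + 1)) edge_of P)"

definition G :: "(int \<Rightarrow> real^2) \<Rightarrow> (int \<Rightarrow> real^2) \<Rightarrow> real \<Rightarrow> int \<Rightarrow> int \<Rightarrow> real" where
  "G e v lam i j = 1 - lam * (e i \<bullet> v j)"

definition G_minor :: "(int \<Rightarrow> real^2) \<Rightarrow> (int \<Rightarrow> real^2) \<Rightarrow> real \<Rightarrow> int \<Rightarrow> int \<Rightarrow> real" where
  "G_minor e v lam i j =
     G e v lam i j * G e v lam (i+1) (j+1) - G e v lam i (j+1) * G e v lam (i+1) j"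

definition pairing_minor :: "(int \<Rightarrow> real^2) \<Rightarrow> (int \<Rightarrow> real^2) \<Rightarrow> int \<Rightarrow> int \<Rightarrow> real" where
  "pairing_minor e v i j =
     (e i \<bullet> v j) * (e (i+1) \<bullet> v (j+1)) - (e i \<bullet> v (j+1)) * (e (i+1) \<bullet> v j)"

definition abs_log_cross_ratio ::
    "(int \<Rightarrow> real^2) \<Rightarrow> (int \<Rightarrow> real^2) \<Rightarrow> real \<Rightarrow> int \<Rightarrow> int \<Rightarrow> real" where
  "abs_log_cross_ratio e v lam i j =
     \<bar>ln ((G e v lam i j * G e v lam (i+1) (j+1)) / (G e v lam i (j+1) * G e v lam (i+1) j))\<bar>"

text \<open>If \<open>G_minor e v lam i j = 0\<close>, the logarithm vanishes as well and both summands below are of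
  the form 0/0 (with value 0 in HOL). The singularity is removable, and the mathematically
  meaningful value is the limit.

  The derivative of \<open>ball_volume_fun\<close> is one half of the double sum of these terms; the factor
  is the area of a triangle spanned by the centre and two consecutive vertices of the polar
  polygon. For the square \<open>[-1,1]^2\<close> the volume is \<open>8 artanh(lam)^2\<close>, while the full double sum
  is \<open>32 artanh(lam) / (1 - lam^2)\<close>.\<close>
definition summand1 :: "(int \<Rightarrow> real^2) \<Rightarrow> (int \<Rightarrow> real^2) \<Rightarrow> int \<Rightarrow> int \<Rightarrow> real \<Rightarrow> real" where
  "summand1 e v i j lam =
     lam * abs_log_cross_ratio e v lam i j * (\<bar>pairing_minor e v i j\<bar> / \<bar>G_minor e v lam i j\<bar>)"

definition summand2 :: "(int \<Rightarrow> real^2) \<Rightarrow> (int \<Rightarrow> real^2) \<Rightarrow> int \<Rightarrow> int \<Rightarrow> real \<Rightarrow> real" where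
  "summand2 e v i j lam =
     abs_log_cross_ratio e v lam i j *
     inverse \<bar>lam - (e i \<bullet> v j + e (i+1) \<bullet> v (j+1) - e i \<bullet> v (j+1) - e (i+1) \<bullet> v j)
                     / pairing_minor e v i j\<bar>"

end

theory Submission
  imports Defs
begin

text \<open>
  The idea is that both the polygon \<open>P\<close> and its polars split into triangles with a common apex,
  and that the volume element of the Funk geometry is an explicit rational function.

  For \<open>x\<close> in the interior of \<open>P\<close> the polar body \<open>polar_at P x\<close> has the vertices
  \<open>e i / (1 - e i \<bullet> x)\<close>. Cutting it along the rays from the origin through these
  vertices shows (\<open>measure_polar_at\<close>) that its area is half the sum over \<open>i\<close> of
  \<open>\<bar>det2 (e i) (e (i + 1))\<bar> / ((1 - e i \<bullet> x) * (1 - e (i + 1) \<bullet> x))\<close>.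
  The ball \<open>r P\<close> is cut along the rays through the vertices \<open>v j\<close>. On the triangle between the rays
  through \<open>v j\<close> and \<open>v (j + 1)\<close> the coordinates \<open>x = s ((1 - t) v j + t v (j + 1))\<close> with
  \<open>0 \<le> s \<le> r\<close> and \<open>0 \<le> t \<le> 1\<close> have the Jacobian \<open>s \<bar>det2 (v j) (v (j + 1))\<bar>\<close>, so the volume of
  the ball is an integral over \<open>s\<close> from \<open>0\<close> to \<open>r\<close> (\<open>ball_volume_fun_eq\<close>), and its derivative in
  \<open>r\<close> is the integrand at \<open>s = r\<close> (\<open>ball_volume_fun_derivative\<close>).

  On the segment from \<open>v j\<close> to \<open>v (j + 1)\<close> scaled by \<open>r\<close> the affine function
  \<open>1 - e i \<bullet> x\<close> interpolates between \<open>G e v r i j\<close> and \<open>G e v r i (j + 1)\<close>. Hence each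
  pair \<open>(i, j)\<close> contributes an integral over \<open>t\<close> of the reciprocal of a product of two affine
  functions, which is the logarithm of a cross ratio divided by \<open>G_minor e v r i j\<close>
  (\<open>recip_integral_eq\<close>). The two determinants multiply to \<open>pairing_minor e v i j\<close>, which produces
  \<open>summand1\<close>; factoring \<open>r\<close> times \<open>pairing_minor e v i j\<close> out of \<open>G_minor e v r i j\<close> produces
  \<open>summand2\<close>. The factor one half in front of the double sum is that of the triangle areas. The
  integral form is continuous in \<open>r\<close> also where \<open>G_minor\<close> vanishes, so it is the limit of both
  summands there.

  Both triangulations come from one construction. If \<open>Q\<close> is the set where all functionals
  \<open>a k\<close> are at most \<open>1\<close>, the plane is divided according to which \<open>a i\<close> is the largest, and
  this region is the cone spanned by the edge of \<open>Q\<close> on the line \<open>a i \<bullet> x = 1\<close>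
  (\<open>sector_eq_cone\<close>). The regions cover the plane by definition and overlap only on lines.
\<close>

section \<open>Integrals over triangles in the plane\<close>

definition det2 :: "real^2 \<Rightarrow> real^2 \<Rightarrow> real" where
  "det2 a b = a$1 * b$2 - a$2 * b$1"

lemma det2_scaleR: "det2 (c *\<^sub>R a) (d *\<^sub>R b) = c * d * det2 a b"
  by (simp add: det2_def algebra_simps)

lemma borel_measurable_vector_pair:
  "(\<lambda>z :: real \<times> real. vector [fst z, snd z] :: real^2) \<in> borel_measurable borel"
proof -
  have "(\<lambda>z :: real \<times> real. vector [fst z, snd z] :: real^2) =
      (\<lambda>z. fst z *\<^sub>R axis 1 1 + snd z *\<^sub>R axis 2 1)"
    by (auto simp: vec_eq_iff forall_2 axis_def)
  also have "\<dots> \<in> borel_measurable borel"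
    by (intro borel_measurable_continuous_onI continuous_intros)
  finally show ?thesis .
qed

lemma lborel_plane_eq_distr_pair:
  "distr (lborel :: (real \<times> real) measure) borel (\<lambda>z. vector [fst z, snd z] :: real^2) = lborel"
    (is "distr _ _ ?J = _")
proof (rule lborel_eqI[symmetric])
  note borel_measurable_vector_pair[measurable]
  fix l u :: "real^2"
  assume "\<And>b. b \<in> Basis \<Longrightarrow> l \<bullet> b \<le> u \<bullet> b"
  then have le: "l $ i \<le> u $ i" for i
    by (metis axis_in_Basis_iff cart_eq_inner_axis inner_real_def mult.right_neutral real_inner_1_right insertI1 Basis_real_def)
  have "?J -` box l u = box (l$1) (u$1) \<times> box (l$2) (u$2)"
    by (auto simp: mem_box_cart forall_2)
  then have "emeasure (distr lborel borel ?J) (box l u) =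
      emeasure (lborel \<Otimes>\<^sub>M lborel) (box (l$1) (u$1) \<times> box (l$2) (u$2))"
    by (simp add: emeasure_distr lborel_prod)
  also have "\<dots> = ennreal (u$1 - l$1) * ennreal (u$2 - l$2)"
    using le by (subst lborel.emeasure_pair_measure_Times) auto
  also have "\<dots> = (\<Prod>b\<in>Basis. (u - l) \<bullet> b)"
    using le by (simp add: Basis_vec_def UNIV_2 axis_eq_axis inner_axis ennreal_mult mult.commute)
  finally show "emeasure (distr lborel borel ?J) (box l u) = (\<Prod>b\<in>Basis. (u - l) \<bullet> b)" .
qed simp

text \<open>
  A linear map scales the volume of every set by its determinant. As an equation between measures
  this can be inserted into integrals.
\<close>
lemma lborel_eq_density_distr_linear:
  fixes L :: "real ^ 'n::{finite,wellorder} \<Rightarrow> real ^ 'n::_"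
  assumes "linear L" and "det (matrix L) \<noteq> 0"
  shows "density (distr lborel borel L) (\<lambda>_. ennreal \<bar>det (matrix L)\<bar>) = lborel"
proof (rule lborel_eqI[symmetric])
  have meas[measurable]: "L \<in> borel_measurable lborel"
    using linear_continuous_on[of L UNIV] assms(1) borel_measurable_continuous_onI
    by (simp add: linear_conv_bounded_linear)
  have bij: "bij L"
    using assms by (simp add: det_nz_iff_inj linear_injective_imp_surjective bij_def)
  obtain L' where L': "linear L'" "\<And>x. L' (L x) = x" "\<And>x. L (L' x) = x"
    using assms linear_injective_isomorphism det_nz_iff_inj by metis
  fix l u :: "real ^ 'n::{finite,wellorder}"
  assume le: "\<And>b. b \<in> Basis \<Longrightarrow> l \<bullet> b \<le> u \<bullet> b"
  let ?B = "L -` box l u"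
  have B: "?B = L' ` box l u"
    using L' by (auto simp: image_iff) metis
  have mB: "?B \<in> lmeasurable"
    unfolding B by (rule measurable_linear_image[OF L'(1)]) auto
  have sB: "?B \<in> sets lborel"
    using measurable_sets[OF meas, of "box l u"] by simp
  have "measure lebesgue (L ` ?B) = \<bar>det (matrix L)\<bar> * measure lebesgue ?B"
    by (rule measure_linear_image[OF assms(1) mB])
  moreover have "L ` ?B = box l u"
    using bij by (simp add: bij_is_surj surj_image_vimage_eq)
  ultimately have eq: "\<bar>det (matrix L)\<bar> * measure lborel ?B = measure lborel (box l u)"
    using sB by simp
  have "emeasure lborel ?B = ennreal (measure lborel ?B)"
    using fmeasurableD2[OF mB] sB by (simp add: emeasure_eq_ennreal_measure)
  then have "emeasure (density (distr lborel borel L) (\<lambda>_. ennreal \<bar>det (matrix L)\<bar>)) (box l u) =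
    ennreal \<bar>det (matrix L)\<bar> * ennreal (measure lborel ?B)"
    by (simp add: emeasure_density nn_integral_distr nn_integral_cmult emeasure_distr)
  also have "\<dots> = ennreal (measure lborel (box l u))"
    by (simp add: eq ennreal_mult[symmetric])
  also have "\<dots> = (\<Prod>b\<in>Basis. (u - l) \<bullet> b)"
    using le by simp
  finally show "emeasure (density (distr lborel borel L) (\<lambda>_. ennreal \<bar>det (matrix L)\<bar>)) (box l u)
    = (\<Prod>b\<in>Basis. (u - l) \<bullet> b)" .
qed simp

text \<open>
  Change of variables to the coordinates of the frame \<open>a, b\<close>. The coordinates range over a product
  of two copies of the line, so that Fubini applies to the right-hand side.
\<close>
lemma integral_plane_frame:
  fixes F :: "real^2 \<Rightarrow> real"
  assumes "det2 a b \<noteq> 0" and F: "integrable lborel F"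
  shows "integrable (lborel :: (real \<times> real) measure) (\<lambda>z. F (fst z *\<^sub>R a + snd z *\<^sub>R b))"
    and "(\<integral>x. F x \<partial>lborel) =
      \<bar>det2 a b\<bar> * (\<integral>z. F (fst z *\<^sub>R a + snd z *\<^sub>R b) \<partial>(lborel :: (real \<times> real) measure))"
proof -
  define L where "L = (\<lambda>x :: real^2. x$1 *\<^sub>R a + x$2 *\<^sub>R b)"
  let ?J = "\<lambda>z :: real \<times> real. vector [fst z, snd z] :: real^2"
  have linL: "linear L"
    by (rule linearI) (auto simp: L_def algebra_simps)
  have det: "det (matrix L) = det2 a b"
    by (simp add: det_2 matrix_def L_def det2_def axis_def)
  note borel_measurable_vector_pair[measurable]
  have L[measurable]: "L \<in> borel_measurable borel"
    using linear_continuous_on[of L UNIV] linL borel_measurable_continuous_onI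
    by (simp add: linear_conv_bounded_linear)
  have Fm[measurable]: "F \<in> borel_measurable borel"
    using F by auto
  have eq: "lborel = density (distr (distr lborel borel ?J) borel L) (\<lambda>_. ennreal \<bar>det2 a b\<bar>)"
    using lborel_eq_density_distr_linear[OF linL] det assms(1) lborel_plane_eq_distr_pair by simp
  have LJ: "L (?J z) = fst z *\<^sub>R a + snd z *\<^sub>R b" for z
    by (simp add: L_def)
  have "integrable (density (distr (distr lborel borel ?J) borel L) (\<lambda>_. ennreal \<bar>det2 a b\<bar>)) F"
    using F eq by simp
  then have "integrable (lborel :: (real \<times> real) measure) (\<lambda>z. \<bar>det2 a b\<bar> * F (fst z *\<^sub>R a + snd z *\<^sub>R b))"
    by (simp add: integrable_density integrable_distr_eq LJ del: integrable_mult_right_iff)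
  then show "integrable (lborel :: (real \<times> real) measure) (\<lambda>z. F (fst z *\<^sub>R a + snd z *\<^sub>R b))"
    using assms(1) by simp
  show "(\<integral>x. F x \<partial>lborel) =
      \<bar>det2 a b\<bar> * (\<integral>z. F (fst z *\<^sub>R a + snd z *\<^sub>R b) \<partial>(lborel :: (real \<times> real) measure))"
    by (subst eq) (simp add: integral_density integral_distr LJ)
qed

text \<open>
  The triangle with the vertices \<open>0\<close>, \<open>r a\<close> and \<open>r b\<close>, in the coordinates in which it is
  recognised as a piece of the cone spanned by \<open>a\<close> and \<open>b\<close>.
\<close>
definition triangle :: "real^2 \<Rightarrow> real^2 \<Rightarrow> real \<Rightarrow> (real^2) set" where
  "triangle a b r = {x. \<exists>s t. 0 \<le> s \<and> 0 \<le> t \<and> s + t \<le> r \<and> x = s *\<^sub>R a + t *\<^sub>R b}"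

lemma det2_independent:
  assumes "det2 a b \<noteq> 0" "s *\<^sub>R a + t *\<^sub>R b = s' *\<^sub>R a + t' *\<^sub>R b"
  shows "s = s'" "t = t'"
proof -
  have 1: "s * a$1 + t * b$1 = s' * a$1 + t' * b$1"
    using arg_cong[OF assms(2), of "\<lambda>x. x$1"] by simp
  have 2: "s * a$2 + t * b$2 = s' * a$2 + t' * b$2"
    using arg_cong[OF assms(2), of "\<lambda>x. x$2"] by simp
  have "(s - s') * det2 a b = 0" "(t - t') * det2 a b = 0"
    using 1 2 unfolding det2_def by algebra+
  then show "s = s'" "t = t'" using assms(1) by auto
qed

lemma compact_triangle: "compact (triangle a b r)"
proof -
  have "triangle a b r = (\<lambda>z. fst z *\<^sub>R a + snd z *\<^sub>R b) ` ({z. 0 \<le> fst z \<and> 0 \<le> snd z \<and> fst z + snd z \<le> r} :: (real\<times>real) set)"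
    by (auto simp: triangle_def image_iff) force
  moreover have "compact ({z. 0 \<le> fst z \<and> 0 \<le> snd z \<and> fst z + snd z \<le> r} :: (real\<times>real) set)"
  proof -
    have "closed ({z. 0 \<le> fst z \<and> 0 \<le> snd z \<and> fst z + snd z \<le> r} :: (real\<times>real) set)"
      by (intro closed_Collect_conj closed_Collect_le continuous_intros)
    moreover have "({z. 0 \<le> fst z \<and> 0 \<le> snd z \<and> fst z + snd z \<le> r} :: (real\<times>real) set) \<subseteq> {0..r} \<times> {0..r}"
      by auto
    then have "bounded ({z. 0 \<le> fst z \<and> 0 \<le> snd z \<and> fst z + snd z \<le> r} :: (real\<times>real) set)"
      by (rule bounded_subset[rotated]) (intro bounded_Times bounded_closed_interval)
    ultimately show ?thesis by (simp add: compact_eq_bounded_closed)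
  qed
  ultimately show ?thesis
    by (auto intro!: compact_continuous_image continuous_intros)
qed

lemma integrable_indicator_triangle:
  fixes f :: "real^2 \<Rightarrow> real"
  assumes "continuous_on (triangle a b r) f"
  shows "integrable lborel (\<lambda>x. indicator (triangle a b r) x * f x)"
  using borel_integrable_compact[OF compact_triangle assms] by simp

lemma mem_triangle_ray:
  assumes "s \<in> {0..r}" "t \<in> {0..1}"
  shows "s *\<^sub>R ((1 - t) *\<^sub>R a + t *\<^sub>R b) \<in> triangle a b r"
proof -
  have "s * (1 - t) + s * t \<le> r"
    using assms by (simp add: algebra_simps)
  with assms show ?thesis
    unfolding triangle_def
    by (intro CollectI exI[of _ "s * (1 - t)"] exI[of _ "s * t"]) (auto simp: scaleR_add_right)
qed

lemma continuous_on_ray_integral: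
  fixes f :: "real^2 \<Rightarrow> real"
  assumes f: "continuous_on (triangle a b r) f"
  shows "continuous_on {0..r} (\<lambda>s. s * integral {0..1} (\<lambda>t. f (s *\<^sub>R ((1 - t) *\<^sub>R a + t *\<^sub>R b))))"
proof -
  have "continuous_on ({0..r} \<times> {0..1}) (\<lambda>(s, t). f (s *\<^sub>R ((1 - t) *\<^sub>R a + t *\<^sub>R b)))"
    unfolding case_prod_beta using mem_triangle_ray
    by (intro continuous_on_compose2[OF f] continuous_intros) auto
  then have "continuous_on {0..r} (\<lambda>s. integral (cbox 0 1) (\<lambda>t. f (s *\<^sub>R ((1 - t) *\<^sub>R a + t *\<^sub>R b))))"
    by (intro integral_continuous_on_param) simp
  then show ?thesis
    by (intro continuous_intros) simp
qed

text \<open>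
  In the frame \<open>a, b - a\<close> the triangle becomes \<open>0 \<le> y \<le> x \<le> r\<close>. Fubini and the substitution
  \<open>y = x t\<close> in the inner integral give the formula, and the factor \<open>s\<close> is the Jacobian of that
  substitution.
\<close>
lemma integral_triangle:
  fixes f :: "real^2 \<Rightarrow> real"
  assumes det: "det2 a b \<noteq> 0" and r: "0 \<le> r" and f: "continuous_on (triangle a b r) f"
  shows "(\<integral>x. indicator (triangle a b r) x * f x \<partial>lborel) =
    \<bar>det2 a b\<bar> * integral {0..r} (\<lambda>s. s * integral {0..1} (\<lambda>t. f (s *\<^sub>R ((1 - t) *\<^sub>R a + t *\<^sub>R b))))"
proof -
  define F where "F = (\<lambda>x. indicator (triangle a b r) x * f x)"
  define h where "h = (\<lambda>s. s * integral {0..1} (\<lambda>t. f (s *\<^sub>R ((1 - t) *\<^sub>R a + t *\<^sub>R b))))"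
  have det': "det2 a (b - a) = det2 a b"
    by (simp add: det2_def algebra_simps)
  have intF: "integrable lborel F"
    unfolding F_def by (rule integrable_indicator_triangle[OF f])
  have mem: "x *\<^sub>R a + y *\<^sub>R (b - a) \<in> triangle a b r \<longleftrightarrow> 0 \<le> y \<and> y \<le> x \<and> x \<le> r" for x y
  proof -
    have eq: "x *\<^sub>R a + y *\<^sub>R (b - a) = (x - y) *\<^sub>R a + y *\<^sub>R b"
      by (simp add: algebra_simps)
    show ?thesis unfolding eq
    proof
      assume "(x - y) *\<^sub>R a + y *\<^sub>R b \<in> triangle a b r"
      then obtain s t where st: "0 \<le> s" "0 \<le> t" "s + t \<le> r" "(x - y) *\<^sub>R a + y *\<^sub>R b = s *\<^sub>R a + t *\<^sub>R b"
        by (auto simp: triangle_def)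
      then show "0 \<le> y \<and> y \<le> x \<and> x \<le> r"
        using det2_independent[OF det st(4)] by auto
    next
      assume "0 \<le> y \<and> y \<le> x \<and> x \<le> r"
      then show "(x - y) *\<^sub>R a + y *\<^sub>R b \<in> triangle a b r"
        unfolding triangle_def by (intro CollectI exI[of _ "x - y"] exI[of _ y]) auto
    qed
  qed
  have conth: "continuous_on {0..r} h"
    unfolding h_def by (rule continuous_on_ray_integral[OF f])
  have inner: "(\<integral>y. F (x *\<^sub>R a + y *\<^sub>R (b - a)) \<partial>lborel) = indicator {0..r} x * h x" if "x \<noteq> 0" for x
  proof (cases "x \<in> {0..r}")
    case True
    with that have "x > 0" by auto
    have eqF: "F (x *\<^sub>R a + (0 + x * t) *\<^sub>R (b - a)) =
        indicator {0..1} t *\<^sub>R f (x *\<^sub>R ((1 - t) *\<^sub>R a + t *\<^sub>R b))" for t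
    proof -
      have "x *\<^sub>R ((1 - t) *\<^sub>R a + t *\<^sub>R b) = x *\<^sub>R a + (x * t) *\<^sub>R (b - a)"
        by (simp add: algebra_simps)
      then show ?thesis
        using \<open>x > 0\<close> True
        by (auto simp: F_def indicator_def mem zero_le_mult_iff mult_le_cancel_left)
    qed
    have "(\<integral>y. F (x *\<^sub>R a + y *\<^sub>R (b - a)) \<partial>lborel) =
        x * (LINT t:{0..1}|lborel. f (x *\<^sub>R ((1 - t) *\<^sub>R a + t *\<^sub>R b)))"
      using \<open>x > 0\<close>
      by (subst lborel_integral_real_affine[of x _ 0])
         (simp_all only: eqF set_lebesgue_integral_def, auto)
    also have "(LINT t:{0..1}|lborel. f (x *\<^sub>R ((1 - t) *\<^sub>R a + t *\<^sub>R b))) =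
        integral {0..1} (\<lambda>t. f (x *\<^sub>R ((1 - t) *\<^sub>R a + t *\<^sub>R b)))"
      using True mem_triangle_ray
      by (intro set_borel_integral_eq_integral borel_integrable_atLeastAtMost'
            continuous_on_compose2[OF f] continuous_intros) auto
    finally show ?thesis using True by (simp add: h_def)
  next
    case False
    then have "F (x *\<^sub>R a + y *\<^sub>R (b - a)) = 0" for y
      by (auto simp: F_def indicator_def mem)
    with False show ?thesis by simp
  qed
  note frame = integral_plane_frame[OF _ intF, of a "b - a", unfolded det', OF det]
  have "integrable (lborel \<Otimes>\<^sub>M lborel) (\<lambda>(x, y). F (x *\<^sub>R a + y *\<^sub>R (b - a)))"
    using frame(1) by (simp add: lborel_prod case_prod_beta')
  from lborel_pair.integral_fst[OF this]
  have "(\<integral>z. F (fst z *\<^sub>R a + snd z *\<^sub>R (b - a)) \<partial>lborel) =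
      (\<integral>x. (\<integral>y. F (x *\<^sub>R a + y *\<^sub>R (b - a)) \<partial>lborel) \<partial>lborel)"
    by (simp add: lborel_prod case_prod_beta')
  also have "\<dots> = (LINT x:{0..r}|lborel. h x)"
    unfolding set_lebesgue_integral_def real_scaleR_def
  proof (rule integral_cong_AE)
    have "integrable (lborel \<Otimes>\<^sub>M lborel) (\<lambda>(x, y). F (x *\<^sub>R a + y *\<^sub>R (b - a)))" by fact
    from lborel_pair.integrable_fst[OF this]
    show "(\<lambda>x. \<integral>y. F (x *\<^sub>R a + y *\<^sub>R (b - a)) \<partial>lborel) \<in> borel_measurable lborel" by auto
    show "(\<lambda>x. indicator {0..r} x * h x) \<in> borel_measurable lborel"
      using borel_integrable_atLeastAtMost'[OF conth] by (auto simp: set_integrable_def)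
    \<comment> \<open>The substitution degenerates at the apex, so that value is excluded.\<close>
    show "AE x in lborel. (\<integral>y. F (x *\<^sub>R a + y *\<^sub>R (b - a)) \<partial>lborel) = indicator {0..r} x * h x"
      using AE_lborel_singleton[of "0::real"] by eventually_elim (rule inner)
  qed
  also have "\<dots> = integral {0..r} h"
    by (intro set_borel_integral_eq_integral borel_integrable_atLeastAtMost' conth)
  finally show ?thesis
    using frame(2) by (simp add: F_def h_def)
qed

lemma measure_triangle:
  assumes "det2 a b \<noteq> 0"
  shows "measure lborel (triangle a b 1) = \<bar>det2 a b\<bar> / 2"
proof -
  have "measure lborel (triangle a b 1) = (\<integral>x. indicator (triangle a b 1) x * 1 \<partial>lborel)"
    by simp
  also have "\<dots> = \<bar>det2 a b\<bar> * integral {0..1} (\<lambda>s. s * integral {0..1} (\<lambda>t :: real. 1 :: real))"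
    by (rule integral_triangle[OF assms, of 1 "\<lambda>_. 1"]) auto
  also have "integral {0..1} (\<lambda>s. s * integral {0..1} (\<lambda>t :: real. 1 :: real)) = 1 / 2"
    by simp
  finally show ?thesis by simp
qed

section \<open>The fan of cones over the edges of a polygon\<close>

lemma collinear_unit_functional:
  assumes "det2 b c \<noteq> 0" "a \<bullet> b = 1" "a \<bullet> c = 1" "a \<bullet> p = 1"
  obtains t where "p = (1 - t) *\<^sub>R b + t *\<^sub>R c"
proof -
  obtain s t where p: "p = s *\<^sub>R b + t *\<^sub>R c"
  proof
    show "p = (det2 p c / det2 b c) *\<^sub>R b + (det2 b p / det2 b c) *\<^sub>R c"
      using assms(1) by (simp add: vec_eq_iff forall_2 field_simps) (simp add: det2_def algebra_simps)
  qed
  have "s + t = 1"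
    using assms p by (simp add: inner_add_right)
  then have "s = 1 - t" by simp
  with p that show ?thesis by blast
qed

text \<open>
  A line that misses the origin meets every line through the origin in at most one point.
\<close>
lemma det2_nonzero_of_unit_functional:
  assumes "a \<bullet> b = 1" "a \<bullet> c = 1" "b \<noteq> c"
  shows "det2 b c \<noteq> 0"
proof
  assume 0: "det2 b c = 0"
  have 1: "a$1 * b$1 + a$2 * b$2 = 1" "a$1 * c$1 + a$2 * c$2 = 1"
    using assms(1,2) by (simp_all add: inner_vec_def sum_2)
  have "b$1 = c$1" "b$2 = c$2"
    using 0 1 unfolding det2_def by algebra+
  then show False using assms(3) by (simp add: vec_eq_iff forall_2)
qed

lemma unbounded_ray:
  fixes x :: "'a::real_normed_vector"
  assumes "bounded S" "\<And>c. 0 \<le> c \<Longrightarrow> c *\<^sub>R x \<in> S"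
  shows "x = 0"
proof (rule ccontr)
  assume "x \<noteq> 0"
  obtain B where B: "\<And>y. y \<in> S \<Longrightarrow> norm y \<le> B"
    using assms(1) by (auto simp: bounded_iff)
  have "B \<ge> 0" using B[OF assms(2)[of 0]] by simp
  then have "norm (((B + 1) / norm x) *\<^sub>R x) \<le> B"
    by (intro B assms(2)) auto
  then show False using \<open>x \<noteq> 0\<close> \<open>B \<ge> 0\<close> by simp
qed

text \<open>
  The polygon \<open>Q\<close> is given at the same time by its edge functionals \<open>a i\<close> and by its vertices
  \<open>b i\<close>; the edge of \<open>a i\<close> is the segment from \<open>b i\<close> to \<open>b (i + 1)\<close>. The locale is stated so
  that a polygon and its polar are both instances, with the two families exchanged.
\<close>
locale polygon_fan =
  fixes a b :: "int \<Rightarrow> real^2" and I :: "int set" and Q :: "(real^2) set"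
  assumes finite_I: "finite I" and nonempty_I: "I \<noteq> {}"
    and inj_a: "inj_on a I"
    and unit: "\<And>i. i \<in> I \<Longrightarrow> a i \<bullet> b i = 1" "\<And>i. i \<in> I \<Longrightarrow> a i \<bullet> b (i + 1) = 1"
    and distinct: "\<And>i. i \<in> I \<Longrightarrow> b i \<noteq> b (i + 1)"
    and mem_Q_iff: "\<And>x. x \<in> Q \<longleftrightarrow> (\<forall>i\<in>I. a i \<bullet> x \<le> 1)"
    and bounded_Q: "bounded Q"
    and extreme: "\<And>i. b i extreme_point_of Q"
begin

definition sector :: "int \<Rightarrow> (real^2) set" where
  "sector i = {x. \<forall>k\<in>I. a k \<bullet> x \<le> a i \<bullet> x}"

lemma det2_nonzero: "i \<in> I \<Longrightarrow> det2 (b i) (b (i + 1)) \<noteq> 0"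
  using det2_nonzero_of_unit_functional unit distinct by blast

lemma a_b_le_1: "i \<in> I \<Longrightarrow> a i \<bullet> b k \<le> 1"
  using extreme[of k] mem_Q_iff by (auto simp: extreme_point_of_def)

text \<open>
  The points of \<open>Q\<close> on the line \<open>a i \<bullet> p = 1\<close> stay between \<open>b i\<close> and \<open>b (i + 1)\<close>: a point of
  \<open>Q\<close> on that line beyond one of them would make that one an inner point of a segment in \<open>Q\<close>.
\<close>
lemma edge_segment:
  assumes "i \<in> I" "p \<in> Q" "a i \<bullet> p = 1"
  obtains t where "0 \<le> t" "t \<le> 1" "p = (1 - t) *\<^sub>R b i + t *\<^sub>R b (i + 1)"
proof -
  obtain t where p: "p = (1 - t) *\<^sub>R b i + t *\<^sub>R b (i + 1)"
    using collinear_unit_functional[OF det2_nonzero unit assms(3)] assms(1) by blast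
  have Q: "b i \<in> Q" "b (i + 1) \<in> Q" using extreme by (auto simp: extreme_point_of_def)
  have ne: "b i \<noteq> b (i + 1)" using distinct assms(1) by blast
  have "\<not> t > 1"
  proof
    assume t: "t > 1"
    have "b (i + 1) = (1 - 1 / t) *\<^sub>R b i + (1 / t) *\<^sub>R p"
      using t by (simp add: p algebra_simps)
    moreover have "p \<noteq> b i"
      using p t ne by (auto simp: algebra_simps)
    ultimately have "b (i + 1) \<in> open_segment (b i) p"
      using t unfolding in_segment by (auto intro!: exI[of _ "1 / t"])
    then show False using extreme[of "i + 1"] Q assms(2) by (auto simp: extreme_point_of_def)
  qed
  moreover have "\<not> t < 0"
  proof
    assume t: "t < 0"
    have "b i = (1 - 1 / (1 - t)) *\<^sub>R b (i + 1) + (1 / (1 - t)) *\<^sub>R p"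
    proof -
      have c: "1 - 1 / (1 - t) = - (t / (1 - t))" using t by (simp add: field_simps)
      have "b i = (1 / (1 - t)) *\<^sub>R ((1 - t) *\<^sub>R b i)" using t by simp
      also have "(1 - t) *\<^sub>R b i = p - t *\<^sub>R b (i + 1)" by (simp add: p)
      finally show ?thesis unfolding c by (simp add: scaleR_diff_right)
    qed
    moreover have "p \<noteq> b (i + 1)"
    proof
      assume "p = b (i + 1)"
      then have "(1 - t) *\<^sub>R (b i - b (i + 1)) = 0" using p by (simp add: algebra_simps)
      then show False using t ne by simp
    qed
    ultimately have "b i \<in> open_segment (b (i + 1)) p"
      using t unfolding in_segment by (auto intro!: exI[of _ "1 / (1 - t)"])
    then show False using extreme[of i] Q assms(2) by (auto simp: extreme_point_of_def)
  qed
  ultimately show ?thesis using that[of t] p by simp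
qed

text \<open>
  If \<open>a i\<close> is the largest functional at \<open>x\<close> and its value \<open>r\<close> is positive, then \<open>x / r\<close> lies
  in \<open>Q\<close> on the edge of \<open>a i\<close>. If the value is not positive, the whole ray through \<open>x\<close> lies in
  the bounded set \<open>Q\<close>, so that \<open>x\<close> is zero.
\<close>
lemma sector_eq_cone:
  assumes "i \<in> I"
  shows "sector i = {x. \<exists>s t. 0 \<le> s \<and> 0 \<le> t \<and> x = s *\<^sub>R b i + t *\<^sub>R b (i + 1)}"
proof (intro set_eqI iffI)
  fix x assume x: "x \<in> sector i"
  show "x \<in> {x. \<exists>s t. 0 \<le> s \<and> 0 \<le> t \<and> x = s *\<^sub>R b i + t *\<^sub>R b (i + 1)}"
  proof (cases "a i \<bullet> x \<le> 0")
    case True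
    then have "a k \<bullet> x \<le> 0" if "k \<in> I" for k
      using x that by (force simp: sector_def)
    then have "c *\<^sub>R x \<in> Q" if "0 \<le> c" for c
      using that by (auto simp: mem_Q_iff) (meson mult_nonneg_nonpos order_trans zero_le_one)
    then have "x = 0" by (rule unbounded_ray[OF bounded_Q])
    then show ?thesis by (auto intro!: exI[of _ 0])
  next
    case False
    define r where "r = a i \<bullet> x"
    have r: "r > 0" using False by (simp add: r_def)
    have "(1 / r) *\<^sub>R x \<in> Q"
      using x r by (auto simp: mem_Q_iff sector_def r_def)
    moreover have "a i \<bullet> ((1 / r) *\<^sub>R x) = 1" using r by (simp add: r_def)
    ultimately obtain t where t: "0 \<le> t" "t \<le> 1" "(1 / r) *\<^sub>R x = (1 - t) *\<^sub>R b i + t *\<^sub>R b (i + 1)"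
      using edge_segment[OF assms] by blast
    have "x = r *\<^sub>R ((1 / r) *\<^sub>R x)" using r by simp
    also have "\<dots> = (r * (1 - t)) *\<^sub>R b i + (r * t) *\<^sub>R b (i + 1)"
      unfolding t(3) by (simp add: scaleR_add_right)
    finally show ?thesis
      using r t by (intro CollectI exI[of _ "r * (1 - t)"] exI[of _ "r * t"]) auto
  qed
next
  fix x assume "x \<in> {x. \<exists>s t. 0 \<le> s \<and> 0 \<le> t \<and> x = s *\<^sub>R b i + t *\<^sub>R b (i + 1)}"
  then obtain s t where st: "0 \<le> s" "0 \<le> t" "x = s *\<^sub>R b i + t *\<^sub>R b (i + 1)" by blast
  have "a k \<bullet> x \<le> a i \<bullet> x" if "k \<in> I" for k
  proof -
    have "a k \<bullet> x = s * (a k \<bullet> b i) + t * (a k \<bullet> b (i + 1))"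
      using st by (simp add: inner_add_right)
    also have "\<dots> \<le> s * 1 + t * 1"
      using st a_b_le_1[OF that] by (intro add_mono mult_left_mono)
    also have "\<dots> = a i \<bullet> x" using unit[OF assms] st by (simp add: inner_add_right)
    finally show ?thesis .
  qed
  then show "x \<in> sector i" by (simp add: sector_def)
qed

lemma sectors_cover: "\<exists>i\<in>I. x \<in> sector i"
proof -
  obtain i where "i \<in> I" "\<forall>k\<in>I. a k \<bullet> x \<le> a i \<bullet> x"
    using finite_I nonempty_I finite_has_maximal[of "(\<lambda>k. a k \<bullet> x) ` I"]
    by (auto) (metis linorder_le_cases)
  then show ?thesis by (auto simp: sector_def)
qed

text \<open>
  A common point of two sectors lies on the line where two distinct functionals agree.
\<close>
lemma AE_sectors_disjoint:
  "AE x in lborel. \<forall>i\<in>I. \<forall>k\<in>I. x \<in> sector i \<and> x \<in> sector k \<longrightarrow> i = k"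
proof -
  have "AE x in lborel. x \<in> sector i \<and> x \<in> sector k \<longrightarrow> i = k" if "i \<in> I" "k \<in> I" for i k
  proof (cases "i = k")
    case False
    then have "a i - a k \<noteq> 0" using inj_a that by (auto simp: inj_on_def)
    then have "negligible {x. (a i - a k) \<bullet> x = 0}"
      by (intro negligible_hyperplane) auto
    moreover have "closed {x. (a i - a k) \<bullet> x = 0}"
      by (rule closed_hyperplane)
    ultimately have "{x. (a i - a k) \<bullet> x = 0} \<in> null_sets lborel"
      by (simp add: negligible_iff_null_sets null_sets_completion_iff)
    then have "AE x in lborel. x \<notin> {x. (a i - a k) \<bullet> x = 0}" by (rule AE_not_in)
    then show ?thesis
      by eventually_elim (use that in \<open>auto simp: sector_def inner_diff_left antisym\<close>)
  qed simp
  then show ?thesis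
    using finite_I by (intro AE_finite_allI) auto
qed

lemma integral_eq_sum_sectors:
  fixes F :: "real^2 \<Rightarrow> real"
  assumes int: "\<And>i. i \<in> I \<Longrightarrow> integrable lborel (\<lambda>x. indicator (sector i) x * F x)"
    and meas: "F \<in> borel_measurable lborel"
  shows "(\<integral>x. F x \<partial>lborel) = (\<Sum>i\<in>I. \<integral>x. indicator (sector i) x * F x \<partial>lborel)"
proof -
  have "AE x in lborel. F x = (\<Sum>i\<in>I. indicator (sector i) x * F x)"
    using AE_sectors_disjoint
  proof eventually_elim
    case (elim x)
    obtain i where i: "i \<in> I" "x \<in> sector i" using sectors_cover by blast
    have "(\<Sum>k\<in>I. indicator (sector k) x * F x) = (\<Sum>k\<in>I. if k = i then F x else 0)"
      using elim i by (intro sum.cong) (auto simp: indicator_def)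
    then show ?case using i finite_I by simp
  qed
  moreover have "(\<lambda>x. \<Sum>i\<in>I. indicator (sector i) x * F x) \<in> borel_measurable lborel"
    using int by (intro borel_measurable_sum) auto
  ultimately have "(\<integral>x. F x \<partial>lborel) = (\<integral>x. (\<Sum>i\<in>I. indicator (sector i) x * F x) \<partial>lborel)"
    using meas by (intro integral_cong_AE)
  also have "\<dots> = (\<Sum>i\<in>I. \<integral>x. indicator (sector i) x * F x \<partial>lborel)"
    using int by (rule Bochner_Integration.integral_sum)
  finally show ?thesis .
qed

end

section \<open>A one-dimensional integral\<close>

text \<open>
  The cross ratio term in a form that makes sense also for \<open>A * D = B * C\<close>, where the quotient of
  the logarithm and the determinant is \<open>0 / 0\<close>.
\<close>
definition recip_integral :: "real \<Rightarrow> real \<Rightarrow> real \<Rightarrow> real \<Rightarrow> real" where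
  "recip_integral A B C D =
     integral {0..1} (\<lambda>t. 1 / (((1 - t) * A + t * B) * ((1 - t) * C + t * D)))"

lemma convex_comb_pos:
  fixes A B t :: real
  assumes "0 < A" "0 < B" "0 \<le> t" "t \<le> 1"
  shows "0 < (1 - t) * A + t * B"
proof (cases "t = 0")
  case False
  then show ?thesis using assms by (intro add_nonneg_pos) auto
qed (use assms in simp)

lemma integrable_recip:
  assumes "0 < A" "0 < B" "0 < C" "0 < D"
  shows "(\<lambda>t. 1 / (((1 - t) * A + t * B) * ((1 - t) * C + t * D))) integrable_on {0..1::real}"
proof (rule integrable_continuous_real)
  have "(1 - t) * A + t * B \<noteq> 0" "(1 - t) * C + t * D \<noteq> 0" if "t \<in> {0..1}" for t
    using convex_comb_pos[of A B t] convex_comb_pos[of C D t] assms that by fastforce+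
  then show "continuous_on {0..1} (\<lambda>t. 1 / (((1 - t) * A + t * B) * ((1 - t) * C + t * D)))"
    by (intro continuous_intros) auto
qed

text \<open>
  Up to the constant factor \<open>1 / (A * D - B * C)\<close>, the integrand is the derivative of the logarithm
  of the quotient of the two affine functions.
\<close>
lemma recip_integral_eq:
  assumes pos: "0 < A" "0 < B" "0 < C" "0 < D" and ne: "A * D - B * C \<noteq> 0"
  shows "recip_integral A B C D = ln ((A * D) / (B * C)) / (A * D - B * C)"
proof -
  let ?a = "\<lambda>t. (1 - t) * A + t * B" and ?c = "\<lambda>t. (1 - t) * C + t * D"
  let ?\<Delta> = "A * D - B * C"
  have "((\<lambda>t. 1 / (?a t * ?c t)) has_integral
      (ln (?c 1) - ln (?a 1)) / ?\<Delta> - (ln (?c 0) - ln (?a 0)) / ?\<Delta>) {0..1}"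
  proof (rule fundamental_theorem_of_calculus)
    fix t :: real assume t: "t \<in> {0..1}"
    have a: "0 < ?a t" and c: "0 < ?c t" using t pos by (auto intro: convex_comb_pos)
    have "((\<lambda>t. (ln (?c t) - ln (?a t)) / ?\<Delta>) has_real_derivative
        ((D - C) / ?c t - (B - A) / ?a t) / ?\<Delta>) (at t within {0..1})"
      using a c ne by (auto intro!: derivative_eq_intros)
    moreover have "(D - C) / ?c t - (B - A) / ?a t = ?\<Delta> / (?a t * ?c t)"
    proof -
      have "(D - C) / ?c t - (B - A) / ?a t = ((D - C) * ?a t - (B - A) * ?c t) / (?a t * ?c t)"
        using a c by (simp add: diff_frac_eq mult.commute)
      also have "(D - C) * ?a t - (B - A) * ?c t = ?\<Delta>" by (simp add: algebra_simps)
      finally show ?thesis .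
    qed
    ultimately show "((\<lambda>t. (ln (?c t) - ln (?a t)) / ?\<Delta>) has_vector_derivative
        1 / (?a t * ?c t)) (at t within {0..1})"
      using ne by (simp add: has_real_derivative_iff_has_vector_derivative)
  qed simp
  then have "recip_integral A B C D = (ln D - ln B) / ?\<Delta> - (ln C - ln A) / ?\<Delta>"
    unfolding recip_integral_def by (intro integral_unique) simp
  also have "\<dots> = ln ((A * D) / (B * C)) / ?\<Delta>"
    using pos by (simp add: ln_mult ln_div diff_divide_distrib add_divide_distrib)
  finally show ?thesis .
qed

text \<open>
  The absolute values can be inserted because the integral is positive: the logarithm and the
  determinant have the same sign.
\<close>
lemma abs_ln_divide_eq_recip_integral:
  assumes pos: "0 < A" "0 < B" "0 < C" "0 < D" and ne: "A * D - B * C \<noteq> 0"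
  shows "\<bar>ln ((A * D) / (B * C))\<bar> / \<bar>A * D - B * C\<bar> = recip_integral A B C D"
proof -
  have "0 \<le> recip_integral A B C D"
    unfolding recip_integral_def using pos
    by (intro integral_nonneg integrable_recip) (auto simp: convex_comb_pos less_imp_le)
  then have "\<bar>ln ((A * D) / (B * C)) / (A * D - B * C)\<bar> = recip_integral A B C D"
    using recip_integral_eq[OF assms] by (metis abs_of_nonneg)
  then show ?thesis by (simp only: abs_divide)
qed

lemma continuous_on_recip_integral:
  assumes "continuous_on S A" "continuous_on S B" "continuous_on S C" "continuous_on S D"
    and "\<And>x. x \<in> S \<Longrightarrow> 0 < A x" "\<And>x. x \<in> S \<Longrightarrow> 0 < B x"
      "\<And>x. x \<in> S \<Longrightarrow> 0 < C x" "\<And>x. x \<in> S \<Longrightarrow> 0 < D x"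
  shows "continuous_on S (\<lambda>x. recip_integral (A x) (B x) (C x) (D x))"
proof -
  have ne: "(1 - t) * A x + t * B x \<noteq> 0" "(1 - t) * C x + t * D x \<noteq> 0"
    if "x \<in> S" "t \<in> {0..1}" for x t
    using convex_comb_pos[of "A x" "B x" t] convex_comb_pos[of "C x" "D x" t] assms(5-8) that
    by fastforce+
  have "continuous_on (S \<times> cbox 0 1) (\<lambda>(x, t). 1 / (((1 - t) * A x + t * B x) * ((1 - t) * C x + t * D x)))"
    unfolding case_prod_beta
    by (intro continuous_intros assms(1-4)[THEN continuous_on_compose2]) (auto dest: ne)
  then show ?thesis
    unfolding recip_integral_def box_real[symmetric] by (rule integral_continuous_on_param)
qed

section \<open>Periodic enumerations of vertices\<close>

lemma periodic_shift:
  assumes "\<forall>i. f (i + int m) = f i"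
  shows "f (i + k * int m) = f i"
proof (induction k rule: int_induct[where k = 0])
  case (step1 k)
  have "f (i + (k + 1) * int m) = f ((i + k * int m) + int m)" by (simp add: algebra_simps)
  then show ?case using assms step1 by simp
next
  case (step2 k)
  have "f (i + k * int m) = f ((i + (k - 1) * int m) + int m)" by (simp add: algebra_simps)
  then show ?case using assms step2 by simp
qed simp

lemma periodic_representative:
  assumes "\<forall>i. f (i + int m) = f i" "m > 0"
  obtains j where "j \<in> {1..int m}" "f j = f i" "int m dvd i - j"
proof -
  define j where "j = (i - 1) mod int m + 1"
  have i: "i = j + ((i - 1) div int m) * int m"
    by (simp add: j_def)
  show ?thesis
  proof
    show "j \<in> {1..int m}"
      using assms(2) pos_mod_bound[of "int m" "i - 1"] pos_mod_sign[of "int m" "i - 1"]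
      unfolding j_def atLeastAtMost_iff by linarith
    show "f j = f i" using periodic_shift[OF assms(1), of j "(i - 1) div int m"] i by metis
    show "int m dvd i - j" using i by (metis add_diff_cancel_left' dvd_triv_right)
  qed
qed

lemma consecutive_vertices_extreme:
  assumes "consecutive_vertices S m f" "m > 0"
  shows "f i extreme_point_of S"
proof -
  have "\<forall>i. f (i + int m) = f i" using assms by (simp add: consecutive_vertices_def)
  then obtain j where "j \<in> {1..int m}" "f j = f i"
    using assms(2) by (rule periodic_representative)
  then have "f i \<in> f ` {1..int m}" by (metis imageI)
  also have "\<dots> = {x. x extreme_point_of S}"
    using assms by (simp add: consecutive_vertices_def)
  finally show ?thesis by simp
qed

text \<open>
  Injectivity on one period extends to the integers modulo \<open>m\<close>. This is needed for indices such as
  \<open>i + 1\<close> that leave the range from \<open>1\<close> to \<open>m\<close>.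
\<close>
lemma consecutive_vertices_eq_iff:
  assumes "consecutive_vertices S m f" "m > 0"
  shows "f i = f k \<longleftrightarrow> int m dvd i - k"
proof
  assume eq: "f i = f k"
  have per: "\<forall>i. f (i + int m) = f i" and inj: "inj_on f {1..int m}"
    using assms by (auto simp: consecutive_vertices_def)
  obtain j j' where j: "j \<in> {1..int m}" "f j = f i" "int m dvd i - j"
      and j': "j' \<in> {1..int m}" "f j' = f k" "int m dvd k - j'"
    using periodic_representative[OF per assms(2)] by metis
  have "j = j'" using inj j j' eq by (auto simp: inj_on_def)
  then have "int m dvd (i - j) - (k - j)" using j(3) j'(3) \<open>j = j'\<close>
    by (metis dvd_diff)
  then show "int m dvd i - k" by simp
next
  assume "int m dvd i - k"
  then obtain c where "i = k + c * int m" by (auto simp: dvd_def) (metis add.commute diff_add_cancel mult.commute)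
  then show "f i = f k"
    using periodic_shift[of f m k c] assms by (auto simp: consecutive_vertices_def)
qed

section \<open>Polar bodies\<close>

lemma polar_at_eq_Inter: "polar_at K x = (\<Inter>y\<in>K. {\<xi>. \<xi> \<bullet> (y - x) \<le> 1})"
  by (auto simp: polar_at_def)

lemma closed_polar_at: "closed (polar_at K x)"
  unfolding polar_at_eq_Inter by (intro closed_INT ballI closed_Collect_le continuous_intros)

lemma convex_polar_at: "convex (polar_at K x)"
  unfolding polar_at_eq_Inter
  by (intro convex_INT) (simp add: inner_commute[of _ "_ - _"] convex_halfspace_le)

lemma bounded_polar:
  assumes "0 \<in> interior K"
  shows "bounded (polar K)"
proof -
  obtain r where r: "r > 0" "cball 0 r \<subseteq> K"
    using assms mem_interior_cball by blast
  have "norm \<xi> \<le> 1 / r" if "\<xi> \<in> polar K" for \<xi>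
  proof (cases "\<xi> = 0")
    case False
    have "(r / norm \<xi>) *\<^sub>R \<xi> \<in> K" using r False by (intro subsetD[OF r(2)]) auto
    then have "\<xi> \<bullet> ((r / norm \<xi>) *\<^sub>R \<xi>) \<le> 1" using that by (auto simp: polar_at_def)
    moreover have "\<xi> \<bullet> ((r / norm \<xi>) *\<^sub>R \<xi>) = r * norm \<xi>"
      using False by (simp add: dot_square_norm power2_eq_square)
    ultimately show ?thesis using r by (simp add: field_simps)
  qed (use r in auto)
  then show ?thesis by (auto simp: bounded_iff)
qed

text \<open>
  The inclusion of the bipolar theorem that is not a tautology: a hyperplane that separates \<open>x\<close>
  from \<open>K\<close> yields, after normalisation, a point of the polar whose value at \<open>x\<close> exceeds \<open>1\<close>.
\<close>
lemma mem_of_polar_le_1: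
  assumes "closed K" "convex K" "0 \<in> K" "\<And>\<xi>. \<xi> \<in> polar K \<Longrightarrow> \<xi> \<bullet> x \<le> 1"
  shows "x \<in> K"
proof (rule ccontr)
  assume "x \<notin> K"
  then obtain a c where ac: "a \<bullet> x < c" "\<forall>y\<in>K. c < a \<bullet> y"
    using separating_hyperplane_closed_point[OF assms(2,1)] by blast
  have "c < 0" using ac assms(3) by force
  have "(1 / c) *\<^sub>R a \<in> polar K"
    using ac \<open>c < 0\<close> by (auto simp: polar_at_def field_simps less_imp_le)
  then have "(1 / c) *\<^sub>R a \<bullet> x \<le> 1" by (rule assms(4))
  then show False using ac \<open>c < 0\<close> by (simp add: field_simps)
qed

section \<open>A polygon and its polar\<close>

locale dual_polygons =
  fixes P :: "(real^2) set" and m :: nat and v e :: "int \<Rightarrow> real^2"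
  assumes polytope_P: "polytope P" and interior_P: "0 \<in> interior P" and m_ge_3: "m \<ge> 3"
    and vertices_P: "consecutive_vertices P m v"
    and vertices_polar: "consecutive_vertices (polar P) m e"
    and incidence: "e i \<bullet> v i = 1" "e i \<bullet> v (i - 1) = 1"
begin

abbreviation I :: "int set" where "I \<equiv> {1..int m}"

lemma incidence': "e (i + 1) \<bullet> v i = 1"
  using incidence(2)[of "i + 1"] by simp

lemma P_eq_hull: "P = convex hull (v ` I)"
  using Krein_Milman_Minkowski[of P] polytope_P vertices_P
  by (auto simp: consecutive_vertices_def polytope_imp_compact polytope_imp_convex)

lemma polar_eq_hull: "polar P = convex hull (e ` I)"
proof -
  have "compact (polar P)"
    using bounded_polar[OF interior_P] closed_polar_at by (simp add: compact_eq_bounded_closed)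
  then show ?thesis
    using Krein_Milman_Minkowski[of "polar P"] convex_polar_at vertices_polar
    by (auto simp: consecutive_vertices_def)
qed

lemma mem_polar_iff: "\<xi> \<in> polar P \<longleftrightarrow> (\<forall>i\<in>I. v i \<bullet> \<xi> \<le> 1)"
proof
  assume "\<xi> \<in> polar P"
  then show "\<forall>i\<in>I. v i \<bullet> \<xi> \<le> 1"
    using hull_subset[of "v ` I" convex] unfolding P_eq_hull[symmetric]
    by (auto simp: polar_at_def inner_commute[of "v _"])
next
  assume "\<forall>i\<in>I. v i \<bullet> \<xi> \<le> 1"
  then have "convex hull (v ` I) \<subseteq> {y. \<xi> \<bullet> y \<le> 1}"
    by (intro hull_minimal convex_halfspace_le) (auto simp: inner_commute)
  then show "\<xi> \<in> polar P"
    unfolding P_eq_hull[symmetric] by (auto simp: polar_at_def)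
qed

text \<open>
  The bipolar theorem: the extreme points of the polar suffice as functionals because the polar is
  their convex hull.
\<close>
lemma mem_P_iff: "x \<in> P \<longleftrightarrow> (\<forall>i\<in>I. e i \<bullet> x \<le> 1)"
proof
  assume "x \<in> P"
  then show "\<forall>i\<in>I. e i \<bullet> x \<le> 1"
    using hull_subset[of "e ` I" convex] unfolding polar_eq_hull[symmetric] by (auto simp: polar_at_def)
next
  assume "\<forall>i\<in>I. e i \<bullet> x \<le> 1"
  then have "convex hull (e ` I) \<subseteq> {\<xi>. x \<bullet> \<xi> \<le> 1}"
    by (intro hull_minimal convex_halfspace_le) (auto simp: inner_commute)
  then have le: "\<xi> \<bullet> x \<le> 1" if "\<xi> \<in> polar P" for \<xi>
    using that unfolding polar_eq_hull[symmetric] by (auto simp: inner_commute)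
  show "x \<in> P"
  proof (rule mem_of_polar_le_1)
    show "closed P" "convex P"
      using polytope_P by (simp_all add: polytope_imp_closed polytope_imp_convex)
    show "0 \<in> P" using interior_P interior_subset by blast
  qed (rule le)
qed

lemma m_not_dvd_1: "\<not> int m dvd 1" "\<not> int m dvd -1"
  using m_ge_3 by auto

lemma fan_polar: "polygon_fan v e I (polar P)"
proof
  show "inj_on v I" using vertices_P by (simp add: consecutive_vertices_def)
  show "e i \<noteq> e (i + 1)" for i
    using consecutive_vertices_eq_iff[OF vertices_polar] m_ge_3 m_not_dvd_1 by simp
  show "e i extreme_point_of polar P" for i
    using consecutive_vertices_extreme[OF vertices_polar] m_ge_3 by simp
  show "v i \<bullet> e i = 1" "v i \<bullet> e (i + 1) = 1" for i
    using incidence(1)[of i] incidence'[of i] by (simp_all add: inner_commute)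
  show "I \<noteq> {}" using m_ge_3 by simp
  show "finite I" by simp
  show "\<xi> \<in> polar P \<longleftrightarrow> (\<forall>i\<in>I. v i \<bullet> \<xi> \<le> 1)" for \<xi> by (rule mem_polar_iff)
  show "bounded (polar P)" using interior_P by (rule bounded_polar)
qed

text \<open>
  The edge from \<open>v j\<close> to \<open>v (j + 1)\<close> lies on the line of \<open>e (j + 1)\<close>, which explains the shift of
  the functionals.
\<close>
lemma fan_P: "polygon_fan (\<lambda>j. e (j + 1)) v I P"
proof
  show "inj_on (\<lambda>j. e (j + 1)) I"
  proof (rule inj_onI)
    fix i k assume ik: "i \<in> I" "k \<in> I" "e (i + 1) = e (k + 1)"
    then have "int m dvd i - k"
      using consecutive_vertices_eq_iff[OF vertices_polar] m_ge_3 by simp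
    with ik show "i = k"
      using dvd_imp_le_int[of "i - k" "int m"] by (cases "i = k") auto
  qed
  show "v i \<noteq> v (i + 1)" for i
    using consecutive_vertices_eq_iff[OF vertices_P] m_ge_3 m_not_dvd_1 by simp
  show "v i extreme_point_of P" for i
    using consecutive_vertices_extreme[OF vertices_P] m_ge_3 by simp
  show "x \<in> P \<longleftrightarrow> (\<forall>i\<in>I. e (i + 1) \<bullet> x \<le> 1)" for x
  proof
    assume "x \<in> P"
    moreover have "e (i + 1) \<in> polar P" for i
      using consecutive_vertices_extreme[OF vertices_polar] m_ge_3 by (simp add: extreme_point_of_def)
    ultimately show "\<forall>i\<in>I. e (i + 1) \<bullet> x \<le> 1" by (auto simp: polar_at_def)
  next
    assume *: "\<forall>i\<in>I. e (i + 1) \<bullet> x \<le> 1"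
    have "e i \<bullet> x \<le> 1" for i
    proof -
      have "\<forall>i. e (i + int m) = e i" using vertices_polar by (simp add: consecutive_vertices_def)
      then have "e ((i + 1) + int m) = e (i + 1)" for i by blast
      then have "\<forall>i. e (i + int m + 1) = e (i + 1)" by (simp add: algebra_simps)
      from periodic_representative[OF this, of "i - 1"] m_ge_3
      obtain j where "j \<in> I" "e (j + 1) = e (i - 1 + 1)" by auto
      with * show ?thesis by (metis diff_add_cancel)
    qed
    then show "x \<in> P" by (simp add: mem_P_iff)
  qed
  show "e (i + 1) \<bullet> v i = 1" "e (i + 1) \<bullet> v (i + 1) = 1" for i
    by (rule incidence' incidence(1))+
  show "bounded P" using polytope_P by (rule polytope_imp_bounded)
  show "finite I" "I \<noteq> {}" using m_ge_3 by simp_all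
qed

sublocale E: polygon_fan v e I "polar P"
  by (rule fan_polar)

sublocale V: polygon_fan "\<lambda>j. e (j + 1)" v I P
  by (rule fan_P)

section \<open>The area of the polar bodies\<close>

text \<open>
  Testing \<open>\<xi> = s e i + t e (i + 1)\<close> against the common vertex \<open>v i\<close>, where both functionals take
  their maximum \<open>1\<close> on \<open>P\<close>, already gives the strongest of the conditions that define the polar.
\<close>
lemma polar_at_Int_sector:
  assumes i: "i \<in> I" and pos: "e i \<bullet> x < 1" "e (i + 1) \<bullet> x < 1"
  shows "polar_at P x \<inter> E.sector i =
    triangle ((1 / (1 - e i \<bullet> x)) *\<^sub>R e i) ((1 / (1 - e (i + 1) \<bullet> x)) *\<^sub>R e (i + 1)) 1"
    (is "_ = triangle (?A *\<^sub>R _) (?B *\<^sub>R _) 1")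
proof (intro set_eqI iffI)
  have v: "v i \<in> P" using V.extreme[of i] by (simp add: extreme_point_of_def)
  fix \<xi> assume "\<xi> \<in> polar_at P x \<inter> E.sector i"
  then obtain s t where st: "0 \<le> s" "0 \<le> t" "\<xi> = s *\<^sub>R e i + t *\<^sub>R e (i + 1)"
      and pol: "\<xi> \<in> polar_at P x"
    using E.sector_eq_cone[OF i] by auto
  have "\<xi> \<bullet> (v i - x) \<le> 1" using pol v by (auto simp: polar_at_def)
  moreover have "\<xi> \<bullet> (v i - x) = s * (1 - e i \<bullet> x) + t * (1 - e (i + 1) \<bullet> x)"
    using incidence(1)[of i] incidence'[of i]
    by (simp add: st inner_add_left inner_diff_right algebra_simps)
  ultimately show "\<xi> \<in> triangle (?A *\<^sub>R e i) (?B *\<^sub>R e (i + 1)) 1"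
    using st pos unfolding triangle_def
    by (intro CollectI exI[of _ "s * (1 - e i \<bullet> x)"] exI[of _ "t * (1 - e (i + 1) \<bullet> x)"]) auto
next
  fix \<xi> assume "\<xi> \<in> triangle (?A *\<^sub>R e i) (?B *\<^sub>R e (i + 1)) 1"
  then obtain s' t' where st': "0 \<le> s'" "0 \<le> t'" "s' + t' \<le> 1"
      "\<xi> = s' *\<^sub>R ?A *\<^sub>R e i + t' *\<^sub>R ?B *\<^sub>R e (i + 1)"
    by (auto simp: triangle_def)
  define s t where "s = s' * ?A" and "t = t' * ?B"
  have st: "0 \<le> s" "0 \<le> t" "\<xi> = s *\<^sub>R e i + t *\<^sub>R e (i + 1)"
      "s * (1 - e i \<bullet> x) + t * (1 - e (i + 1) \<bullet> x) \<le> 1"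
    using st' pos by (auto simp: s_def t_def)
  have "\<xi> \<bullet> (y - x) \<le> 1" if "y \<in> P" for y
  proof -
    have "e k \<bullet> y \<le> 1" for k
      using E.extreme[of k] that by (auto simp: extreme_point_of_def polar_at_def)
    then have "s * (e i \<bullet> y - e i \<bullet> x) + t * (e (i + 1) \<bullet> y - e (i + 1) \<bullet> x)
        \<le> s * (1 - e i \<bullet> x) + t * (1 - e (i + 1) \<bullet> x)"
      using st(1,2) by (intro add_mono mult_left_mono diff_right_mono)
    also have "s * (e i \<bullet> y - e i \<bullet> x) + t * (e (i + 1) \<bullet> y - e (i + 1) \<bullet> x) = \<xi> \<bullet> (y - x)"
      by (simp add: st(3) inner_add_left inner_diff_right algebra_simps)
    finally show ?thesis using st(4) by linarith
  qed
  then show "\<xi> \<in> polar_at P x \<inter> E.sector i"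
    using st unfolding E.sector_eq_cone[OF i] by (auto simp: polar_at_def)
qed

text \<open>
  The area of the polygon with the vertices \<open>e i / (1 - e i \<bullet> x)\<close>, as a sum over the triangles
  with apex \<open>0\<close> over its edges.
\<close>
definition polar_area :: "real^2 \<Rightarrow> real" where
  "polar_area x = (\<Sum>i\<in>I. \<bar>det2 (e i) (e (i + 1))\<bar> / 2 * (1 / ((1 - e i \<bullet> x) * (1 - e (i + 1) \<bullet> x))))"

lemma measure_polar_at:
  assumes pos: "\<And>i. e i \<bullet> x < 1"
  shows "measure lborel (polar_at P x) = polar_area x"
proof -
  let ?t = "\<lambda>i. triangle ((1 / (1 - e i \<bullet> x)) *\<^sub>R e i) ((1 / (1 - e (i + 1) \<bullet> x)) *\<^sub>R e (i + 1)) 1"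
  have [measurable]: "polar_at P x \<in> sets borel" using closed_polar_at by (rule borel_closed)
  have eq: "(\<lambda>y. indicator (E.sector i) y * indicator (polar_at P x) y) = (\<lambda>y. indicator (?t i) y * (1::real))"
    if "i \<in> I" for i
    unfolding polar_at_Int_sector[OF that pos pos, symmetric] by (auto simp: indicator_def)
  have "measure lborel (polar_at P x) = (\<integral>y. indicator (polar_at P x) y \<partial>lborel)"
    by simp
  also have "\<dots> = (\<Sum>i\<in>I. \<integral>y. indicator (E.sector i) y * indicator (polar_at P x) y \<partial>lborel)"
  proof (rule E.integral_eq_sum_sectors)
    show "integrable lborel (\<lambda>y. indicator (E.sector i) y * indicator (polar_at P x) y :: real)"
      if "i \<in> I" for i
      unfolding eq[OF that] by (intro integrable_indicator_triangle continuous_intros)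
  qed simp
  also have "\<dots> = (\<Sum>i\<in>I. measure lborel (?t i))"
    by (rule sum.cong) (simp_all only: eq, simp_all)
  also have "\<dots> = polar_area x"
    unfolding polar_area_def
  proof (rule sum.cong)
    fix i assume i: "i \<in> I"
    have p: "0 < 1 - e i \<bullet> x" "0 < 1 - e (i + 1) \<bullet> x" using pos by simp_all
    show "measure lborel (?t i) = \<bar>det2 (e i) (e (i + 1))\<bar> / 2 * (1 / ((1 - e i \<bullet> x) * (1 - e (i + 1) \<bullet> x)))"
      using p E.det2_nonzero[OF i]
      by (subst measure_triangle) (auto simp: det2_scaleR abs_mult less_imp_neq[THEN not_sym])
  qed simp
  finally show ?thesis .
qed

section \<open>The volume of the Funk balls and its derivative\<close>

lemma mem_scaled_P_iff:
  assumes "0 < r"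
  shows "x \<in> (\<lambda>x. r *\<^sub>R x) ` P \<longleftrightarrow> (\<forall>i. e i \<bullet> x \<le> r)"
proof -
  have *: "y \<in> P \<longleftrightarrow> (\<forall>i. e i \<bullet> y \<le> 1)" for y
    using E.extreme mem_P_iff[of y] by (auto simp: extreme_point_of_def polar_at_def)
  have "x \<in> (\<lambda>x. r *\<^sub>R x) ` P \<longleftrightarrow> (1 / r) *\<^sub>R x \<in> P"
    using assms by (auto simp: image_iff intro!: bexI[of _ "(1 / r) *\<^sub>R x"])
  also have "\<dots> \<longleftrightarrow> (\<forall>i. e i \<bullet> x \<le> r)"
    using assms by (simp add: * divide_le_eq)
  finally show ?thesis .
qed

lemma scaled_P_Int_sector:
  assumes j: "j \<in> I" and r: "0 < r"
  shows "(\<lambda>x. r *\<^sub>R x) ` P \<inter> V.sector j = triangle (v j) (v (j + 1)) r"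
proof (intro set_eqI iffI)
  fix x assume "x \<in> (\<lambda>x. r *\<^sub>R x) ` P \<inter> V.sector j"
  then obtain s t where st: "0 \<le> s" "0 \<le> t" "x = s *\<^sub>R v j + t *\<^sub>R v (j + 1)"
      and x: "x \<in> (\<lambda>x. r *\<^sub>R x) ` P"
    unfolding V.sector_eq_cone[OF j] by blast
  have "e (j + 1) \<bullet> x \<le> r" using x mem_scaled_P_iff[OF r] by blast
  then have "s + t \<le> r"
    using incidence(1)[of "j + 1"] incidence'[of j] by (simp add: st inner_add_right)
  with st show "x \<in> triangle (v j) (v (j + 1)) r" by (auto simp: triangle_def)
next
  fix x assume "x \<in> triangle (v j) (v (j + 1)) r"
  then obtain s t where st: "0 \<le> s" "0 \<le> t" "s + t \<le> r" "x = s *\<^sub>R v j + t *\<^sub>R v (j + 1)"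
    by (auto simp: triangle_def)
  have "e k \<bullet> x \<le> r" for k
  proof -
    have le: "e k \<bullet> v l \<le> 1" for l
      using E.extreme[of k] V.extreme[of l] by (auto simp: extreme_point_of_def polar_at_def)
    have "e k \<bullet> x \<le> s * 1 + t * 1"
      unfolding st(4) inner_add_right inner_scaleR_right
      using st(1,2) le by (intro add_mono mult_left_mono)
    with st(3) show ?thesis by simp
  qed
  then show "x \<in> (\<lambda>x. r *\<^sub>R x) ` P \<inter> V.sector j"
    using st unfolding V.sector_eq_cone[OF j] by (auto simp: mem_scaled_P_iff[OF r])
qed

lemma continuous_on_polar_area:
  assumes "0 < r" "r < 1"
  shows "continuous_on ((\<lambda>x. r *\<^sub>R x) ` P) polar_area"
proof -
  have "1 - e i \<bullet> x \<noteq> 0" if "x \<in> (\<lambda>x. r *\<^sub>R x) ` P" for x i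
    using that assms(2) unfolding mem_scaled_P_iff[OF assms(1)] by (auto dest!: spec[of _ i])
  then show ?thesis
    unfolding polar_area_def by (intro continuous_intros) auto
qed

text \<open>
  The integral of \<open>polar_area\<close> over the edge from \<open>v j\<close> to \<open>v (j + 1)\<close> scaled by \<open>s\<close>, with the
  Jacobian factor \<open>s\<close> of the scaling but without the determinant of the two vertices.
\<close>
definition ray_integral :: "int \<Rightarrow> real \<Rightarrow> real" where
  "ray_integral j s = s * integral {0..1} (\<lambda>t. polar_area (s *\<^sub>R ((1 - t) *\<^sub>R v j + t *\<^sub>R v (j + 1))))"

lemma continuous_on_polar_area_triangle:
  assumes "j \<in> I" "0 < r" "r < 1"
  shows "continuous_on (triangle (v j) (v (j + 1)) r) polar_area"
  by (rule continuous_on_subset[OF continuous_on_polar_area[OF assms(2,3)]])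
     (use scaled_P_Int_sector[OF assms(1,2)] in blast)

text \<open>
  On \<open>r P\<close> every \<open>e i \<bullet> x\<close> is at most \<open>r < 1\<close>, so the volume element is the continuous function
  \<open>polar_area\<close> there, and the sectors of \<open>P\<close> cut the ball into triangles.
\<close>
lemma ball_volume_fun_eq:
  assumes r: "0 < r" "r < 1"
  shows "ball_volume_fun P r =
    (\<Sum>j\<in>I. \<bar>det2 (v j) (v (j + 1))\<bar> * integral {0..r} (ray_integral j))"
proof -
  let ?S = "(\<lambda>x. r *\<^sub>R x) ` P"
  let ?F = "\<lambda>x. indicator ?S x * polar_area x"
  have "unit_ball_measure TYPE(real^2) \<noteq> 0"
    using content_ball_pos[of 1 "0 :: real^2"] by (simp add: unit_ball_measure_def)
  moreover have "funk_ball P (- ln (1 - r)) = ?S"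
    using r by (simp add: funk_ball_def)
  ultimately have "ball_volume_fun P r = (\<integral>x. indicator ?S x * measure lborel (polar_at P x) \<partial>lborel)"
    by (simp add: ball_volume_fun_def funk_volume_def set_lebesgue_integral_def)
  also have "\<dots> = (\<integral>x. ?F x \<partial>lborel)"
  proof (rule Bochner_Integration.integral_cong)
    fix x :: "real^2"
    show "indicator ?S x * measure lborel (polar_at P x) = ?F x"
    proof (cases "x \<in> ?S")
      case True
      have "e i \<bullet> x < 1" for i
        using True r unfolding mem_scaled_P_iff[OF r(1)] by (auto intro: le_less_trans)
      then show ?thesis by (simp add: measure_polar_at)
    qed simp
  qed simp
  also have "\<dots> = (\<Sum>j\<in>I. \<integral>x. indicator (V.sector j) x * ?F x \<partial>lborel)"
  proof (rule V.integral_eq_sum_sectors)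
    have "compact ?S"
      using polytope_P by (intro compact_scaling polytope_imp_compact)
    from borel_integrable_compact[OF this continuous_on_polar_area[OF r]]
    show "?F \<in> borel_measurable lborel" by auto
    fix j assume j: "j \<in> I"
    have "(\<lambda>x. indicator (V.sector j) x * ?F x) = (\<lambda>x. indicator (triangle (v j) (v (j + 1)) r) x * polar_area x)"
      unfolding scaled_P_Int_sector[OF j r(1), symmetric] by (auto simp: indicator_def)
    then show "integrable lborel (\<lambda>x. indicator (V.sector j) x * ?F x)"
      using integrable_indicator_triangle[OF continuous_on_polar_area_triangle[OF j r]] by simp
  qed
  also have "\<dots> = (\<Sum>j\<in>I. \<bar>det2 (v j) (v (j + 1))\<bar> * integral {0..r} (ray_integral j))"
  proof (rule sum.cong)
    fix j assume j: "j \<in> I"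
    have "(\<integral>x. indicator (V.sector j) x * ?F x \<partial>lborel) =
        (\<integral>x. indicator (triangle (v j) (v (j + 1)) r) x * polar_area x \<partial>lborel)"
      unfolding scaled_P_Int_sector[OF j r(1), symmetric]
      by (intro Bochner_Integration.integral_cong) (auto simp: indicator_def)
    also have "\<dots> = \<bar>det2 (v j) (v (j + 1))\<bar> * integral {0..r} (ray_integral j)"
      unfolding ray_integral_def using r
      by (intro integral_triangle V.det2_nonzero j continuous_on_polar_area_triangle) auto
    finally show "(\<integral>x. indicator (V.sector j) x * ?F x \<partial>lborel) = \<dots>" .
  qed simp
  finally show ?thesis .
qed

lemma ball_volume_fun_derivative:
  assumes r: "0 < r" "r < 1"
  shows "(ball_volume_fun P has_real_derivative
    (\<Sum>j\<in>I. \<bar>det2 (v j) (v (j + 1))\<bar> * ray_integral j r)) (at r)"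
proof (rule DERIV_cong_ev[THEN iffD2])
  \<comment> \<open>The point \<open>r\<close> has to be an inner point of the interval, hence an end point beyond \<open>r\<close>.\<close>
  define c where "c = (1 + r) / 2"
  have c: "0 < c" "c < 1" "r < c" using r by (auto simp: c_def)
  show "((\<lambda>r. \<Sum>j\<in>I. \<bar>det2 (v j) (v (j + 1))\<bar> * integral {0..r} (ray_integral j)) has_real_derivative
    (\<Sum>j\<in>I. \<bar>det2 (v j) (v (j + 1))\<bar> * ray_integral j r)) (at r)"
  proof (intro DERIV_sum DERIV_cmult)
    fix j assume j: "j \<in> I"
    have "continuous_on {0..c} (ray_integral j)"
      unfolding ray_integral_def
      by (intro continuous_on_ray_integral continuous_on_polar_area_triangle j c)
    from integral_has_real_derivative[OF this, of r]
    show "((\<lambda>r. integral {0..r} (ray_integral j)) has_real_derivative ray_integral j r) (at r)"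
      using r c by (simp add: at_within_Icc_at)
  qed
  show "\<forall>\<^sub>F s in nhds r. ball_volume_fun P s =
      (\<Sum>j\<in>I. \<bar>det2 (v j) (v (j + 1))\<bar> * integral {0..s} (ray_integral j))"
    using eventually_nhds_in_open[of "{0<..<1}" r] r
    by (auto elim!: eventually_mono intro: ball_volume_fun_eq)
qed (rule refl)+

end

section \<open>The summands of the derivative\<close>

text \<open>
  Expanding the minor of \<open>G\<close> leaves the terms of degree one and two in \<open>lam\<close>; the quadratic
  coefficient is the minor of the pairings.
\<close>
lemma G_minor_factor:
  assumes "pairing_minor e v i j \<noteq> 0"
  shows "G_minor e v lam i j = lam * pairing_minor e v i j *
    (lam - (e i \<bullet> v j + e (i+1) \<bullet> v (j+1) - e i \<bullet> v (j+1) - e (i+1) \<bullet> v j) / pairing_minor e v i j)"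
proof -
  have "G_minor e v lam i j = lam * (lam * pairing_minor e v i j -
      (e i \<bullet> v j + e (i+1) \<bullet> v (j+1) - e i \<bullet> v (j+1) - e (i+1) \<bullet> v j))"
    by (simp add: G_minor_def G_def pairing_minor_def algebra_simps)
  moreover have "lam * (lam * p - q) = lam * p * (lam - q / p)" if "p \<noteq> 0" for p q :: real
    using that by (simp add: field_simps)
  ultimately show ?thesis using assms by (simp only:)
qed

lemma summand1_eq_summand2:
  assumes "pairing_minor e v i j \<noteq> 0" "lam > 0"
  shows "summand1 e v i j lam = summand2 e v i j lam"
  using assms unfolding summand1_def summand2_def G_minor_factor[OF assms(1)]
  by (simp add: abs_mult divide_simps)

text \<open>
  Multiplicativity of the determinant for the Gram matrix of two pairs of vectors.
\<close>
lemma pairing_minor_eq_det2: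
  "pairing_minor e v i j = det2 (e i) (e (i + 1)) * det2 (v j) (v (j + 1))"
  by (simp add: pairing_minor_def det2_def inner_vec_def sum_2 algebra_simps)

context dual_polygons
begin

lemma pairing_le_1: "e i \<bullet> v j \<le> 1"
  using E.extreme[of i] V.extreme[of j] by (auto simp: extreme_point_of_def polar_at_def)

lemma G_pos:
  assumes "0 < s" "s < 1"
  shows "0 < G e v s i j"
proof -
  have "s * (e i \<bullet> v j) \<le> s * 1" using assms pairing_le_1 by (intro mult_left_mono) auto
  with assms show ?thesis unfolding G_def by linarith
qed

lemma pairing_minor_nonzero: "i \<in> I \<Longrightarrow> j \<in> I \<Longrightarrow> pairing_minor e v i j \<noteq> 0"
  using E.det2_nonzero V.det2_nonzero by (simp add: pairing_minor_eq_det2)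

text \<open>
  The common value of both summands where the minor of \<open>G\<close> does not vanish, and their limit where it
  does.
\<close>
definition summand_limit :: "int \<Rightarrow> int \<Rightarrow> real \<Rightarrow> real" where
  "summand_limit i j s = s * \<bar>pairing_minor e v i j\<bar> *
    recip_integral (G e v s i j) (G e v s i (j + 1)) (G e v s (i + 1) j) (G e v s (i + 1) (j + 1))"

text \<open>
  Along the edge from \<open>v j\<close> to \<open>v (j + 1)\<close> scaled by \<open>s\<close>, the function \<open>1 - e i \<bullet> x\<close>
  interpolates between two entries of \<open>G\<close>.
\<close>
lemma ray_integral_eq_sum:
  assumes s: "0 < s" "s < 1"
  shows "\<bar>det2 (v j) (v (j + 1))\<bar> * ray_integral j s = 1/2 * (\<Sum>i\<in>I. summand_limit i j s)"
proof -
  let ?x = "\<lambda>t. s *\<^sub>R ((1 - t) *\<^sub>R v j + t *\<^sub>R v (j + 1))"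
  let ?r = "\<lambda>i t. 1 / (((1 - t) * G e v s i j + t * G e v s i (j + 1)) *
    ((1 - t) * G e v s (i + 1) j + t * G e v s (i + 1) (j + 1)))"
  have "1 - e i \<bullet> ?x t = (1 - t) * G e v s i j + t * G e v s i (j + 1)" for i t
    by (simp add: G_def inner_add_right algebra_simps)
  then have "polar_area (?x t) = (\<Sum>i\<in>I. \<bar>det2 (e i) (e (i + 1))\<bar> / 2 * ?r i t)" for t
    by (simp add: polar_area_def)
  then have "integral {0..1} (\<lambda>t. polar_area (?x t)) =
      (\<Sum>i\<in>I. integral {0..1} (\<lambda>t. \<bar>det2 (e i) (e (i + 1))\<bar> / 2 * ?r i t))"
    using s by (simp only:) (intro integral_sum integrable_on_mult_right integrable_recip G_pos finite_atLeastAtMost_int)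
  also have "\<dots> = (\<Sum>i\<in>I. \<bar>det2 (e i) (e (i + 1))\<bar> / 2 * integral {0..1} (?r i))"
    by (simp only: integral_mult_right)
  finally show ?thesis
    by (simp add: ray_integral_def summand_limit_def recip_integral_def pairing_minor_eq_det2
        sum_distrib_left abs_mult mult_ac)
qed

lemma ball_volume_fun_derivative_summand_limit:
  assumes "0 < r" "r < 1"
  shows "(ball_volume_fun P has_real_derivative 1/2 * (\<Sum>i\<in>I. \<Sum>j\<in>I. summand_limit i j r)) (at r)"
proof -
  have "(\<Sum>j\<in>I. \<bar>det2 (v j) (v (j + 1))\<bar> * ray_integral j r) = (\<Sum>j\<in>I. 1/2 * (\<Sum>i\<in>I. summand_limit i j r))"
    by (intro sum.cong refl ray_integral_eq_sum assms)
  also have "\<dots> = 1/2 * (\<Sum>i\<in>I. \<Sum>j\<in>I. summand_limit i j r)"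
    unfolding sum_distrib_left[symmetric] by (subst sum.swap) (rule refl)
  finally show ?thesis using ball_volume_fun_derivative[OF assms] by (simp only:)
qed

lemma summand1_eq_summand_limit:
  assumes "0 < s" "s < 1" "G_minor e v s i j \<noteq> 0"
  shows "summand1 e v i j s = summand_limit i j s"
proof -
  have "summand1 e v i j s = s * \<bar>pairing_minor e v i j\<bar> *
      (abs_log_cross_ratio e v s i j / \<bar>G_minor e v s i j\<bar>)"
    by (simp add: summand1_def)
  also have "abs_log_cross_ratio e v s i j / \<bar>G_minor e v s i j\<bar> =
      recip_integral (G e v s i j) (G e v s i (j + 1)) (G e v s (i + 1) j) (G e v s (i + 1) (j + 1))"
    using assms(3) unfolding abs_log_cross_ratio_def G_minor_def
    by (intro abs_ln_divide_eq_recip_integral G_pos assms(1,2))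
  finally show ?thesis by (simp add: summand_limit_def)
qed

lemma isCont_summand_limit:
  assumes "0 < r" "r < 1"
  shows "isCont (summand_limit i j) r"
proof -
  have "continuous_on {0<..<1} (summand_limit i j)"
    unfolding summand_limit_def
    by (intro continuous_intros continuous_on_recip_integral)
       (auto simp: G_pos, auto simp: G_def intro!: continuous_intros)
  then show ?thesis using assms by (simp add: continuous_on_eq_continuous_at)
qed

text \<open>
  The minor of \<open>G\<close> vanishes for at most one positive parameter, so that in a punctured
  neighbourhood of \<open>r\<close> both summands agree with the continuous function \<open>summand_limit i j\<close>.
\<close>
lemma summands_tendsto:
  assumes r: "0 < r" "r < 1" and ij: "i \<in> I" "j \<in> I"
  shows "(summand1 e v i j \<longlongrightarrow> summand_limit i j r) (at r)"
    and "(summand2 e v i j \<longlongrightarrow> summand_limit i j r) (at r)"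
proof -
  note pm = pairing_minor_nonzero[OF ij]
  let ?q = "(e i \<bullet> v j + e (i+1) \<bullet> v (j+1) - e i \<bullet> v (j+1) - e (i+1) \<bullet> v j) / pairing_minor e v i j"
  have "\<forall>\<^sub>F s in at r. s \<in> {0<..<1}"
    using r by (intro eventually_at_in_open') auto
  moreover have "\<forall>\<^sub>F s in at r. s \<noteq> ?q"
    by (rule eventually_neq_at_within)
  ultimately have ev: "\<forall>\<^sub>F s in at r. summand_limit i j s = summand1 e v i j s \<and> summand_limit i j s = summand2 e v i j s"
  proof eventually_elim
    case (elim s)
    then have "G_minor e v s i j \<noteq> 0"
      using pm by (subst G_minor_factor) auto
    with elim pm show ?case
      using summand1_eq_summand_limit[of s i j] summand1_eq_summand2[of e v i j s] by simp
  qed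
  have lim: "(summand_limit i j \<longlongrightarrow> summand_limit i j r) (at r)"
    using isCont_summand_limit[OF r] by (simp add: isCont_def)
  show "(summand1 e v i j \<longlongrightarrow> summand_limit i j r) (at r)"
    using lim by (rule Lim_transform_eventually) (use ev in \<open>auto elim: eventually_mono\<close>)
  show "(summand2 e v i j \<longlongrightarrow> summand_limit i j r) (at r)"
    using lim by (rule Lim_transform_eventually) (use ev in \<open>auto elim: eventually_mono\<close>)
qed

end

section \<open>The derivative formula\<close>

theorem proposition8p4:
  fixes P :: "(real^2) set" and m :: nat and v e :: "int \<Rightarrow> real^2" and lam :: real
  assumes "polytope P" and "0 \<in> interior P" and "m \<ge> 3"
    and "consecutive_vertices P m v"
    and "consecutive_vertices (polar P) m e"
    and "\<forall>i. e i \<bullet> v i = 1 \<and> e i \<bullet> v (i - 1) = 1"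
    and "0 < lam" and "lam < 1"
  shows
    "((\<forall>i\<in>{1..int m}. \<forall>j\<in>{1..int m}. G_minor e v lam i j \<noteq> 0) \<longrightarrow>
        (ball_volume_fun P has_real_derivative
           1/2 * (\<Sum>i=1..int m. \<Sum>j=1..int m. summand1 e v i j lam)) (at lam) \<and>
        (\<Sum>i=1..int m. \<Sum>j=1..int m. summand1 e v i j lam)
          = (\<Sum>i=1..int m. \<Sum>j=1..int m. summand2 e v i j lam)) \<and>
     (\<exists>T. (\<forall>i\<in>{1..int m}. \<forall>j\<in>{1..int m}.
              (summand1 e v i j \<longlongrightarrow> T i j) (at lam) \<and> (summand2 e v i j \<longlongrightarrow> T i j) (at lam)) \<and>
        (ball_volume_fun P has_real_derivative
           1/2 * (\<Sum>i=1..int m. \<Sum>j=1..int m. T i j)) (at lam))"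
proof -
  interpret dual_polygons P m v e
    using assms by unfold_locales auto
  note deriv = ball_volume_fun_derivative_summand_limit[OF assms(7,8)]
  show ?thesis
  proof (intro conjI impI)
    assume ne: "\<forall>i\<in>I. \<forall>j\<in>I. G_minor e v lam i j \<noteq> 0"
    then have "(\<Sum>i\<in>I. \<Sum>j\<in>I. summand_limit i j lam) = (\<Sum>i\<in>I. \<Sum>j\<in>I. summand1 e v i j lam)"
      using assms(7,8) by (intro sum.cong) (auto simp: summand1_eq_summand_limit)
    with deriv show "(ball_volume_fun P has_real_derivative
        1/2 * (\<Sum>i\<in>I. \<Sum>j\<in>I. summand1 e v i j lam)) (at lam)"
      by simp
    show "(\<Sum>i\<in>I. \<Sum>j\<in>I. summand1 e v i j lam) = (\<Sum>i\<in>I. \<Sum>j\<in>I. summand2 e v i j lam)"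
      using assms(7) by (intro sum.cong refl summand1_eq_summand2 pairing_minor_nonzero)
  next
    show "\<exists>T. (\<forall>i\<in>I. \<forall>j\<in>I.
          (summand1 e v i j \<longlongrightarrow> T i j) (at lam) \<and> (summand2 e v i j \<longlongrightarrow> T i j) (at lam)) \<and>
        (ball_volume_fun P has_real_derivative 1/2 * (\<Sum>i\<in>I. \<Sum>j\<in>I. T i j)) (at lam)"
      using summands_tendsto[OF assms(7,8)] deriv
      by (intro exI[of _ "\<lambda>i j. summand_limit i j lam"]) simp
  qed
qed

end
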